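(* Let $|D|=2$, let $\mathbb{P}_0=(p_{0s})_{s\in D}$ be a probability measure on $D$ with $p_{0s}>0$ for both $s$, and let $c\ge 1$ satisfy $c<\min_{s\in D}\frac{1}{1-p_{0s}}$. Let there be a single risky asset ($K=1$) with non-constant payoff $S:D\to\mathbb{R}$, and put $\underline S=\min_{s\in D}S_s$, $\overline S=\max_{s\in D}S_s$. Let $\alpha\in[0,1/2)$. The following holds for any strictly concave (twice differentiable) utility function $u$: (i) $\operatorname{arg\,max}_{\theta\in\Theta,\,\theta\ge 0}V_\alpha(\theta)$ is unique, finite, and strictly positive if and only if $\underline S<\pi<\overline\pi$. (ii) $\operatorname{arg\,max}_{\theta\in\Theta,\,\theta\le 0}V_\alpha(\theta)$ is unique, finite, and strictly negative if and only if $\underline\pi<\pi<\overline S$.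
   Context: With initial wealth $w_0$ and price $\pi$, $W^\theta=w_0+\theta(S-\pi)$ and $$V_\alpha(\theta)=\alpha\min_{P\in\mathcal{X}}\mathbb{E}_P[u(W^\theta)]+(1-\alpha)\max_{P\in\mathcal{X}}\mathbb{E}_P[u(W^\theta)],$$ where $\mathcal{X}=\{P: P(s)\ge 0\ \forall s\in D,\ \sum_{s}P(s)=1,\ \sum_{s}P(s)^2/p_{0s}\le c\}$. Write $\mathbb{E}_0,\mathbb{S}_0$ for expectation and standard deviation under $\mathbb{P}_0$, $\delta=\sqrt{c-1}\,(2\alpha-1)$, and $$\overline\pi=\mathbb{E}_0[S]+|\delta|\,\mathbb{S}_0[S],\qquad \underline\pi=\mathbb{E}_0[S]-|\delta|\,\mathbb{S}_0[S].$$ The admissible set of positions is $\Theta=\mathbb{R}$ if $u$ is defined on all of $\mathbb{R}$; if $u$ is defined only for positive wealth, then $w_0>0$ and $\Theta=\{\theta\in\mathbb{R}: w_0+\theta(S_s-\pi)>0\ \forall s\in D\}$.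
   Formalization: u is taken strictly increasing; the "if" directions also assume u'(0+)=∞ (u on positive wealth), or u'(−∞)=∞ or u'(+∞)=0 (u on R). Else false: u(x)=x−√(1+x²)/2, p0=(1/2,1/2), c=1, α=0, S=(0,1), w0=0, π=1/10 has no maximiser. *)

theory Defs
  imports "HOL-Probability.Probability"
begin

text \<open>
  States of the world are the elements of a finite type 's, and probability measures on it
  are of type 's pmf. The division by pmf P0 s is meaningful because the reference
  measure is always taken with full support.
\<close>
definition priors :: "'s::finite pmf \<Rightarrow> real \<Rightarrow> 's pmf set" where
  "priors P0 c = {P. (\<Sum>s\<in>UNIV. (pmf P s)\<^sup>2 / pmf P0 s) \<le> c}"

definition std_dev :: "'s pmf \<Rightarrow> ('s \<Rightarrow> real) \<Rightarrow> real" where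
  "std_dev P X = sqrt (measure_pmf.variance P X)"

definition wealth :: "real \<Rightarrow> ('s \<Rightarrow> real) \<Rightarrow> real \<Rightarrow> real \<Rightarrow> 's \<Rightarrow> real" where
  "wealth w0 S \<pi> \<theta> s = w0 + \<theta> * (S s - \<pi>)"

text \<open>
  The set of priors is compact
  and nonempty (for \<open>c \<ge> 1\<close>) and the expectation is continuous in the prior, so the infimum
  and the supremum below are a minimum and a maximum.
\<close>
definition V ::
  "'s::finite pmf \<Rightarrow> real \<Rightarrow> real \<Rightarrow> (real \<Rightarrow> real) \<Rightarrow> real \<Rightarrow> ('s \<Rightarrow> real) \<Rightarrow> real \<Rightarrow> real \<Rightarrow> real"
where
  "V P0 c \<alpha> u w0 S \<pi> \<theta> =
     \<alpha> * (INF P\<in>priors P0 c. measure_pmf.expectation P (\<lambda>s. u (wealth w0 S \<pi> \<theta> s))) +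
     (1 - \<alpha>) * (SUP P\<in>priors P0 c. measure_pmf.expectation P (\<lambda>s. u (wealth w0 S \<pi> \<theta> s)))"

definition \<delta> :: "real \<Rightarrow> real \<Rightarrow> real" where
  "\<delta> c \<alpha> = sqrt (c - 1) * (2 * \<alpha> - 1)"

definition \<pi>_upper :: "'s pmf \<Rightarrow> real \<Rightarrow> real \<Rightarrow> ('s \<Rightarrow> real) \<Rightarrow> real" where
  "\<pi>_upper P0 c \<alpha> S = measure_pmf.expectation P0 S + \<bar>\<delta> c \<alpha>\<bar> * std_dev P0 S"

definition \<pi>_lower :: "'s pmf \<Rightarrow> real \<Rightarrow> real \<Rightarrow> ('s \<Rightarrow> real) \<Rightarrow> real" where
  "\<pi>_lower P0 c \<alpha> S = measure_pmf.expectation P0 S - \<bar>\<delta> c \<alpha>\<bar> * std_dev P0 S"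

text \<open>
  Here \<open>I\<close> is the domain of the utility function: all of the reals, or the positive reals.
  For \<open>I = UNIV\<close> every position is admissible.
\<close>
definition admissible :: "real set \<Rightarrow> real \<Rightarrow> ('s \<Rightarrow> real) \<Rightarrow> real \<Rightarrow> real set" where
  "admissible I w0 S \<pi> = {\<theta>. \<forall>s. wealth w0 S \<pi> \<theta> s \<in> I}"

definition arg_max_set :: "('a \<Rightarrow> real) \<Rightarrow> 'a set \<Rightarrow> 'a set" where
  "arg_max_set f A = {x. is_arg_max f (\<lambda>y. y \<in> A) x}"

definition twice_differentiable_on :: "(real \<Rightarrow> real) \<Rightarrow> real set \<Rightarrow> bool" where
  "twice_differentiable_on u I \<longleftrightarrow>
     (\<forall>x\<in>I. u differentiable (at x) \<and> deriv u differentiable (at x))"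

definition strictly_concave_on :: "real set \<Rightarrow> (real \<Rightarrow> real) \<Rightarrow> bool" where
  "strictly_concave_on I u \<longleftrightarrow>
     (\<forall>x\<in>I. \<forall>y\<in>I. \<forall>t. x \<noteq> y \<and> 0 < t \<and> t < 1 \<longrightarrow>
        (1 - t) * u x + t * u y < u ((1 - t) * x + t * y))"

text \<open>
  A weak form of the Inada conditions. On the positive reals it is the usual condition at
  zero; on the whole line only one of the two usual limits of the marginal utility is required.
  Without such a condition an optimal position need not exist: for instance
  \<open>u x = x - sqrt (1 + x\<^sup>2) / 2\<close> on the whole line has marginal utility between
  1/2 and 3/2, so at a low enough price (still above the lowest payoff) larger positions
  are always better. Similarly \<open>u x = ln (2 + x)\<close> on the positive reals can push the optimum
  to the boundary of the open set of admissible positions.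
\<close>
definition inada :: "real set \<Rightarrow> (real \<Rightarrow> real) \<Rightarrow> bool" where
  "inada I u \<longleftrightarrow>
     (if I = UNIV
      then filterlim (deriv u) at_top at_bot \<or> (deriv u \<longlongrightarrow> 0) at_top
      else filterlim (deriv u) at_top (at_right 0))"

end

theory Submission
  imports Defs
begin

text \<open>
  With two states, a prior is determined by the probability of the state with the higher payoff,
  and the set of priors becomes a symmetric interval around the reference probability. For
  positions of a fixed sign the worst and the best prior are therefore the two endpoints, so
  \<open>V\<close> is an ordinary expected utility under one prior, whose mean payoff is the bound
  \<open>\<pi>_upper\<close> (for long positions). Jensen's inequality rules out a long position above this
  bound; below it the marginal value of a position is positive at 0, the Inada condition makes it
  negative eventually, and a zero of it is the unique optimum by strict concavity. Short
  positions reduce to long ones by changing the signs of payoff, price, and position.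
\<close>

section \<open>Strictly concave utilities\<close>

lemma strictly_concave_on_tangent:
  assumes conc: "strictly_concave_on I u" and I: "open I" "convex I"
    and diff: "\<And>x. x \<in> I \<Longrightarrow> u differentiable (at x)"
    and w: "w \<in> I" and z: "z \<in> I" and ne: "z \<noteq> w"
  shows "u z < u w + deriv u w * (z - w)"
proof -
  have "convex_on I (\<lambda>x. - u x)"
  proof (rule convex_onI[OF _ I(2)])
    fix t x y :: real
    assume "0 < t" "t < 1" "x \<in> I" "y \<in> I"
    then show "- u ((1 - t) *\<^sub>R x + t *\<^sub>R y) \<le> (1 - t) * - u x + t * - u y"
      using conc[unfolded strictly_concave_on_def, rule_format, of x y t]
      by (cases "x = y") (auto simp: algebra_simps)
  qed
  moreover have "((\<lambda>x. - u x) has_field_derivative - deriv u w) (at w within I)"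
    using diff[OF w]
    by (intro DERIV_minus[OF has_field_derivative_at_within])
      (simp add: DERIV_deriv_iff_real_differentiable)
  ultimately have tangent: "- u y - - u w \<ge> - deriv u w * (y - w)" if "y \<in> I" for y
    using convex_on_imp_above_tangent[of I "\<lambda>x. - u x" w y "- deriv u w"] that w I
    by (simp add: interior_open convex_connected)
  \<comment> \<open>The tangent bound at the midpoint, which is strictly above the chord, gives strictness.\<close>
  have "(1 - 1/2) * w + 1/2 * z \<in> I"
    using convexD[OF I(2) w z, of "1 - 1/2" "1/2"] by simp
  from tangent[OF this] have "u ((1 - 1/2) * w + 1/2 * z) \<le> u w + deriv u w * (z - w) / 2"
    by (simp add: algebra_simps diff_divide_distrib)
  moreover have "(1 - 1/2) * u w + 1/2 * u z < u ((1 - 1/2) * w + 1/2 * z)"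
    using conc w z ne unfolding strictly_concave_on_def
    by (metis half_gt_zero_iff less_numeral_extra(1) field_sum_of_halves less_add_same_cancel1)
  ultimately show ?thesis by (simp add: field_simps)
qed

locale utility =
  fixes I :: "real set" and u :: "real \<Rightarrow> real" and w0 :: real
  assumes domain: "I = UNIV \<or> (I = {0<..} \<and> w0 > 0)"
    and diff: "twice_differentiable_on u I"
    and mono: "strict_mono_on I u"
    and conc: "strictly_concave_on I u"
begin

lemma w0_in [simp]: "w0 \<in> I"
  using domain by auto

text \<open>This makes admissibility of a position a condition on its poorer state alone, which for
  long positions is the bad state.\<close>

lemma upward: "x \<in> I \<Longrightarrow> x \<le> y \<Longrightarrow> y \<in> I"
  using domain by auto

lemma mono_le: "x \<in> I \<Longrightarrow> x \<le> y \<Longrightarrow> u x \<le> u y"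
  using mono upward by (metis order_le_less strict_mono_onD)

lemma tangent: "w \<in> I \<Longrightarrow> z \<in> I \<Longrightarrow> z \<noteq> w \<Longrightarrow> u z < u w + deriv u w * (z - w)"
  by (rule strictly_concave_on_tangent[OF conc])
    (use domain diff in \<open>auto simp: twice_differentiable_on_def\<close>)

lemma deriv_pos: "w \<in> I \<Longrightarrow> 0 < deriv u w"
  using tangent[of w "w + 1"] strict_mono_onD[OF mono, of w "w + 1"] upward[of w "w + 1"]
  by simp

text \<open>Adding the tangent bounds at \<open>x\<close> and \<open>y\<close>, each evaluated at
  the other point, cancels the values of \<open>u\<close>.\<close>

lemma deriv_antimono:
  assumes "x \<in> I" "x \<le> y"
  shows "deriv u y \<le> deriv u x"
proof (cases "x = y")
  case False
  with assms have "0 < (deriv u x - deriv u y) * (y - x)"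
    using tangent[of x y] tangent[of y x] upward[of x y] by (simp add: algebra_simps)
  with False assms show ?thesis by (simp add: zero_less_mult_iff)
qed simp

text \<open>The second derivative enters only here; it supplies the continuity behind the
  intermediate value argument in \<open>eu_unique_max\<close>.\<close>

lemma deriv_isCont: "w \<in> I \<Longrightarrow> isCont (deriv u) w"
  using diff differentiable_imp_continuous_within unfolding twice_differentiable_on_def by blast

text \<open>
  In what follows \<open>q\<close> is the probability of the good state, and \<open>x\<close> and \<open>y\<close> are the loss in
  the bad state and the gain in the good state per unit of the asset.
\<close>
context
  fixes q x y :: real
  assumes q: "0 < q" "q < 1" and xy: "0 < x + y"
begin

definition eu :: "real \<Rightarrow> real" where
  "eu \<theta> = (1 - q) * u (w0 - \<theta> * x) + q * u (w0 + \<theta> * y)"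

text \<open>The derivative of \<open>eu\<close> in the position. It serves as the slope of combined
  tangent bounds, so \<open>eu\<close> itself is never differentiated.\<close>

definition marginal :: "real \<Rightarrow> real" where
  "marginal \<theta> = q * y * deriv u (w0 + \<theta> * y) - (1 - q) * x * deriv u (w0 - \<theta> * x)"

lemma bad_state_le:
  assumes "0 \<le> \<theta>"
  shows "w0 - \<theta> * x \<le> w0 + \<theta> * y"
  using mult_nonneg_nonneg[OF assms less_imp_le[OF xy]] by (simp add: distrib_left)

lemma good_state_in: "0 \<le> \<theta> \<Longrightarrow> w0 - \<theta> * x \<in> I \<Longrightarrow> w0 + \<theta> * y \<in> I"
  using bad_state_le upward by blast

text \<open>By Jensen, a risky position is worth less than its mean wealth \<open>?z\<close>, and
  the last hypothesis says that the mean gain \<open>q * y - (1 - q) * x\<close> is not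
  positive.\<close>

lemma eu_less_eu_0:
  assumes "0 < \<theta>" "w0 - \<theta> * x \<in> I" "q * (x + y) \<le> x"
  shows "eu \<theta> < eu 0"
proof -
  let ?z = "(1 - q) * (w0 - \<theta> * x) + q * (w0 + \<theta> * y)"
  have gt: "w0 - \<theta> * x < w0 + \<theta> * y"
    using mult_pos_pos[OF assms(1) xy] by (simp add: distrib_left)
  have in_I: "w0 + \<theta> * y \<in> I" using assms good_state_in by simp
  have "eu \<theta> < u ?z"
    using conc gt in_I assms(2) q unfolding eu_def strictly_concave_on_def by auto
  also have "\<dots> \<le> u w0"
  proof (rule mono_le)
    have "?z = w0 - \<theta> * x + q * (\<theta> * (x + y))"
      by (simp add: algebra_simps)
    moreover have "0 \<le> q * (\<theta> * (x + y))"
      using assms q xy by simp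
    ultimately show "?z \<in> I"
      using upward[OF assms(2), of ?z] by linarith
    have "?z = w0 - \<theta> * (x - q * (x + y))"
      by (simp add: algebra_simps)
    moreover have "0 \<le> \<theta> * (x - q * (x + y))"
      using assms by simp
    ultimately show "?z \<le> w0" by linarith
  qed
  also have "u w0 = eu 0"
    by (simp add: eu_def algebra_simps)
  finally show ?thesis .
qed

text \<open>If the bad state brings no loss, then \<open>y > 0\<close>, so enlarging the position
  hurts in neither state and strictly helps in the good one.\<close>

lemma eu_increasing:
  assumes "x \<le> 0" "0 \<le> \<theta>"
  shows "eu \<theta> < eu (\<theta> + 1)"
proof -
  have in_I: "w0 - \<theta> * x \<in> I"
    using assms by (intro upward[OF w0_in]) (simp add: mult_nonneg_nonpos)
  have le: "w0 - \<theta> * x \<le> w0 - (\<theta> + 1) * x" and less: "w0 + \<theta> * y < w0 + (\<theta> + 1) * y"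
    using assms xy by (auto simp: algebra_simps)
  have good: "w0 + \<theta> * y \<in> I" using assms(2) in_I by (rule good_state_in)
  show ?thesis
    unfolding eu_def using q
    by (intro add_le_less_mono mult_left_mono mult_strict_left_mono mono_le[OF in_I le]
        strict_mono_onD[OF mono good upward[OF good less_imp_le[OF less]] less]) auto
qed

text \<open>Either marginal utility explodes in the bad state or it vanishes in the good state,
  while \<open>deriv_antimono\<close> bounds the one in the other state by its value at
  \<open>w0\<close>.\<close>

lemma marginal_eventually_neg:
  assumes "inada I u" "0 < x" "0 < y"
  obtains \<theta> where "0 < \<theta>" "w0 - \<theta> * x \<in> I" "marginal \<theta> < 0"
proof -
  note found = that
  \<comment> \<open>Marginal utility above \<open>?K\<close> in the bad state makes the loss term
    exceed the gain term at position zero.\<close>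
  let ?K = "q * y * deriv u w0 / ((1 - q) * x)"
  have coeff: "0 < (1 - q) * x" "0 < q * y" using q assms by auto
  have loss: thesis if z: "z \<in> I" "z < w0" "?K < deriv u z" for z
  proof -
    \<comment> \<open>The position that brings wealth in the bad state down to exactly
      \<open>z\<close>.\<close>
    define \<theta> where "\<theta> = (w0 - z) / x"
    have \<theta>: "0 < \<theta>" "w0 - \<theta> * x = z" using z assms by (auto simp: \<theta>_def)
    have "q * y * deriv u (w0 + \<theta> * y) \<le> q * y * deriv u w0"
      using coeff \<theta> assms by (intro mult_left_mono deriv_antimono) auto
    also have "\<dots> < (1 - q) * x * deriv u z"
      using z(3) coeff by (simp add: divide_less_eq mult.commute)
    finally show thesis using found \<theta> z by (simp add: marginal_def)
  qed
  consider "I = UNIV" "filterlim (deriv u) at_top at_bot"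
    | "I = UNIV" "(deriv u \<longlongrightarrow> 0) at_top"
    | "I = {0<..}" "w0 > 0" "filterlim (deriv u) at_top (at_right 0)"
    using assms domain by (auto simp: inada_def split: if_splits)
  then show thesis
  proof cases
    case 1
    then have "\<forall>\<^sub>F z in at_bot. ?K < deriv u z \<and> z < w0"
      by (auto simp: filterlim_at_top_dense intro!: eventually_conj)
    then obtain z where "?K < deriv u z" "z < w0"
      using eventually_happens'[OF trivial_limit_at_bot_linorder] by blast
    with loss 1 show thesis by simp
  next
    case 2
    \<comment> \<open>The mirror threshold: marginal utility below \<open>?L\<close> in the good
      state makes the gain term smaller than the loss term at position zero.\<close>
    let ?L = "(1 - q) * x * deriv u w0 / (q * y)"
    have "0 < ?L" using coeff deriv_pos[OF w0_in] by (intro divide_pos_pos mult_pos_pos[of "_ * _"])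
    with 2 have "\<forall>\<^sub>F z in at_top. deriv u z < ?L \<and> w0 < z"
      by (intro eventually_conj eventually_gt_at_top order_tendstoD)
    then obtain z where z: "deriv u z < ?L" "w0 < z"
      using eventually_happens'[OF trivial_limit_at_top_linorder] by blast
    define \<theta> where "\<theta> = (z - w0) / y"
    have \<theta>: "0 < \<theta>" "w0 + \<theta> * y = z" using z assms by (auto simp: \<theta>_def)
    have "q * y * deriv u z < (1 - q) * x * deriv u w0"
      using z(1) coeff by (simp add: less_divide_eq mult.commute)
    also have "\<dots> \<le> (1 - q) * x * deriv u (w0 - \<theta> * x)"
      using coeff \<theta> assms 2 by (intro mult_left_mono deriv_antimono) auto
    finally show thesis using found \<theta> 2 by (simp add: marginal_def)
  next
    case 3
    then have "\<forall>\<^sub>F z in at_right 0. ?K < deriv u z \<and> z \<in> {0<..<w0}"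
      by (intro eventually_conj eventually_at_right_real) (auto simp: filterlim_at_top_dense)
    then obtain z where "?K < deriv u z" "z \<in> {0<..<w0}"
      using eventually_happens'[OF trivial_limit_at_right_real] by blast
    with loss[of z] 3 show thesis by simp
  qed
qed

text \<open>The weighted tangent bounds at \<open>t\<close> add up to
  \<open>eu t + (\<theta> - t) * marginal t\<close>. Strictness comes from the bad state, where
  \<open>0 < x\<close> makes the two wealths differ; in the good state they coincide if
  \<open>y = 0\<close>.\<close>

lemma eu_less_of_marginal_zero:
  assumes "marginal t = 0" "0 < t" "w0 - t * x \<in> I" and "0 \<le> \<theta>" "w0 - \<theta> * x \<in> I"
    and "\<theta> \<noteq> t" "0 < x"
  shows "eu \<theta> < eu t"
proof -
  have "u (w0 - \<theta> * x) < u (w0 - t * x) + deriv u (w0 - t * x) * ((t - \<theta>) * x)"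
    using tangent[of "w0 - t * x" "w0 - \<theta> * x"] assms by (simp add: algebra_simps)
  moreover have "u (w0 + \<theta> * y) \<le> u (w0 + t * y) + deriv u (w0 + t * y) * ((\<theta> - t) * y)"
    using tangent[of "w0 + t * y" "w0 + \<theta> * y"] assms good_state_in[of t] good_state_in[of \<theta>]
    by (cases "y = 0") (simp_all add: algebra_simps)
  ultimately have "eu \<theta> < (1 - q) * (u (w0 - t * x) + deriv u (w0 - t * x) * ((t - \<theta>) * x))
      + q * (u (w0 + t * y) + deriv u (w0 + t * y) * ((\<theta> - t) * y))"
    unfolding eu_def using q by (intro add_less_le_mono mult_strict_left_mono mult_left_mono) auto
  also have "\<dots> = eu t + (\<theta> - t) * marginal t"
    by (simp add: eu_def marginal_def algebra_simps)
  finally show ?thesis using assms by simp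
qed

lemma eu_unique_max:
  assumes "inada I u" "0 < x" "x < q * (x + y)"
  obtains t where "0 < t" "w0 - t * x \<in> I"
    "\<And>\<theta>. 0 \<le> \<theta> \<Longrightarrow> w0 - \<theta> * x \<in> I \<Longrightarrow> \<theta> \<noteq> t \<Longrightarrow> eu \<theta> < eu t"
proof -
  have "q * (x + y) < x + y" using q xy by simp
  then have y: "0 < y" using assms by simp
  from marginal_eventually_neg[OF assms(1,2) y]
  obtain s where s: "0 < s" "w0 - s * x \<in> I" "marginal s < 0" .
  have in_I: "w0 - t * x \<in> I" if "t \<le> s" for t
    using that assms by (intro upward[OF s(2)]) simp
  \<comment> \<open>At position zero both states have wealth \<open>w0\<close>, so the marginal
    value is the mean gain times \<open>deriv u w0\<close>.\<close>
  have "0 < (q * (x + y) - x) * deriv u w0"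
    using assms deriv_pos by simp
  also have "\<dots> = marginal 0" by (simp add: marginal_def algebra_simps)
  finally have m0: "0 < marginal 0" .
  have "isCont marginal t" if "0 \<le> t" "t \<le> s" for t
  proof -
    have "isCont (\<lambda>t. deriv u (w0 - t * x)) t"
      by (rule isCont_o2[where f = "\<lambda>t. w0 - t * x"])
        (intro continuous_intros deriv_isCont in_I that)+
    moreover have "isCont (\<lambda>t. deriv u (w0 + t * y)) t"
      by (rule isCont_o2[where f = "\<lambda>t. w0 + t * y"])
        (intro continuous_intros deriv_isCont good_state_in in_I that)+
    ultimately show ?thesis unfolding marginal_def by (intro continuous_intros)
  qed
  then obtain t where t: "0 \<le> t" "t \<le> s" "marginal t = 0"
    using IVT2[of marginal s 0 0] s m0 by auto
  with m0 have "t > 0" by (cases "t = 0") auto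
  then show thesis
    using eu_less_of_marginal_zero[OF t(3) _ in_I[OF t(2)] _ _ _ assms(2)] in_I[OF t(2)]
    by (intro that)
qed

end

end

section \<open>Priors on two states\<close>

locale two_states =
  fixes P0 :: "'s::finite pmf" and c :: real and a b :: 's
  assumes ab: "a \<noteq> b" and univ: "UNIV = {a, b}"
    and full_support: "\<forall>s. pmf P0 s > 0"
    and c_ge: "1 \<le> c" and c_less: "c < (MIN s. 1 / (1 - pmf P0 s))"
begin

abbreviation "p \<equiv> pmf P0 b"

text \<open>This is \<open>sqrt (c - 1)\<close> times the standard deviation of the indicator of
  \<open>b\<close> under \<open>P0\<close>.\<close>

definition radius :: real where
  "radius = sqrt ((c - 1) * (p * (1 - p)))"

lemma all_univ: "(\<forall>s. Q s) \<longleftrightarrow> Q a \<and> Q b"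
proof -
  have "s = a \<or> s = b" for s
    using UNIV_I[of s] unfolding univ by simp
  then show ?thesis by metis
qed

lemma sum_univ: "sum f UNIV = f a + f b"
  unfolding univ using ab by simp

lemma pmf_a: "pmf P a = 1 - pmf P b"
  using sum_pmf_eq_1[of UNIV P] by (simp add: sum_univ)

lemma expectation_eq:
  "measure_pmf.expectation P X = X a + pmf P b * (X b - X a)" for X :: "'s \<Rightarrow> real"
  using integral_measure_pmf_real[of UNIV P X] by (simp add: sum_univ pmf_a algebra_simps)

lemma p_bounds: "0 < p" "p < 1"
  using full_support pmf_a[of P0] by (auto dest: spec[of _ a])

lemma radius_nonneg: "0 \<le> radius"
  using c_ge p_bounds by (simp add: radius_def)

text \<open>The upper bound on \<open>c\<close> keeps the interval of probabilities strictly inside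
  the unit interval, so nonnegativity of a prior never binds.\<close>

lemma radius_less: "radius < p" "radius < 1 - p"
proof -
  have "c < 1 / (1 - pmf P0 s)" for s
    using c_less by (rule less_le_trans) (intro Min_le, auto)
  from this[of a] this[of b] have c: "c < 1 / p" "c < 1 / (1 - p)" by (auto simp: pmf_a)
  then have "(c - 1) * p < 1 - p" "(c - 1) * (1 - p) < p"
    using p_bounds by (auto simp: field_simps)
  then have "(c - 1) * p * (1 - p) < (1 - p) * (1 - p)" "(c - 1) * (1 - p) * p < p * p"
    using p_bounds by (auto intro: mult_strict_right_mono)
  then show "radius < p" "radius < 1 - p"
    unfolding radius_def using p_bounds
    by (auto intro!: real_less_lsqrt simp: power2_eq_square mult_ac)
qed

text \<open>The constrained sum is one plus the chi-square divergence from \<open>P0\<close>, which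
  for two states is a multiple of the squared deviation at \<open>b\<close>.\<close>

lemma mem_priors_iff: "P \<in> priors P0 c \<longleftrightarrow> \<bar>pmf P b - p\<bar> \<le> radius"
proof -
  have "(pmf P b)\<^sup>2 / p + (1 - pmf P b)\<^sup>2 / (1 - p) = 1 + (pmf P b - p)\<^sup>2 / (p * (1 - p))"
    using p_bounds by (simp add: divide_simps) algebra
  then have "P \<in> priors P0 c \<longleftrightarrow> (pmf P b - p)\<^sup>2 / (p * (1 - p)) \<le> c - 1"
    by (simp add: priors_def sum_univ pmf_a add.commute le_diff_eq)
  also have "\<dots> \<longleftrightarrow> (pmf P b - p)\<^sup>2 \<le> (c - 1) * (p * (1 - p))"
    using p_bounds by (simp add: divide_le_eq)
  finally show ?thesis
    unfolding radius_def by (metis real_sqrt_abs real_sqrt_le_iff)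
qed

text \<open>By \<open>radius_less\<close>, \<open>q\<close> is a probability, so a relabelled
  Bernoulli measure realizes it. This is what makes the endpoints attained.\<close>

lemma prior_exists:
  assumes "\<bar>q - p\<bar> \<le> radius"
  obtains P where "P \<in> priors P0 c" "pmf P b = q"
proof -
  let ?P = "map_pmf (\<lambda>h. if h then b else a) (bernoulli_pmf q)"
  have "(\<lambda>h. if h then b else a) -` {b} = {True}" using ab by (auto split: if_splits)
  then have "pmf ?P b = q"
    using assms radius_less by (simp add: pmf_map measure_pmf_single)
  with assms show thesis by (intro that[of ?P]) (auto simp: mem_priors_iff)
qed

context
  fixes X :: "'s \<Rightarrow> real"
  assumes X: "X a \<le> X b"
begin

text \<open>Since \<open>X a \<le> X b\<close>, the expectation is monotone in the mass of
  \<open>b\<close>, and its extrema lie at the endpoints of the interval.\<close>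

lemma INF_expectation:
  "(INF P\<in>priors P0 c. measure_pmf.expectation P X) = X a + (p - radius) * (X b - X a)"
proof (rule cInf_eq_minimum)
  obtain P where "P \<in> priors P0 c" "pmf P b = p - radius"
    using prior_exists[of "p - radius"] radius_nonneg by auto
  then show "X a + (p - radius) * (X b - X a) \<in> (\<lambda>P. measure_pmf.expectation P X) ` priors P0 c"
    by (auto simp: expectation_eq intro!: image_eqI[of _ _ P])
qed (use X in \<open>auto simp: mem_priors_iff expectation_eq abs_le_iff intro!: mult_right_mono\<close>)

lemma SUP_expectation:
  "(SUP P\<in>priors P0 c. measure_pmf.expectation P X) = X a + (p + radius) * (X b - X a)"
proof (rule cSup_eq_maximum)
  obtain P where "P \<in> priors P0 c" "pmf P b = p + radius"
    using prior_exists[of "p + radius"] radius_nonneg by auto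
  then show "X a + (p + radius) * (X b - X a) \<in> (\<lambda>P. measure_pmf.expectation P X) ` priors P0 c"
    by (auto simp: expectation_eq intro!: image_eqI[of _ _ P])
qed (use X in \<open>auto simp: mem_priors_iff expectation_eq abs_le_iff intro!: mult_right_mono\<close>)

end

text \<open>The endpoints \<open>p - radius\<close> and \<open>p + radius\<close> mixed with weights
  \<open>\<alpha>\<close> and \<open>1 - \<alpha>\<close>.\<close>

definition opt_prob :: "real \<Rightarrow> real" where
  "opt_prob \<alpha> = p + (1 - 2 * \<alpha>) * radius"

lemma opt_prob_bounds:
  assumes "0 \<le> \<alpha>" "\<alpha> < 1 / 2"
  shows "0 < opt_prob \<alpha>" "opt_prob \<alpha> < 1"
proof -
  have "0 \<le> (1 - 2 * \<alpha>) * radius" "(1 - 2 * \<alpha>) * radius \<le> radius"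
    using assms radius_nonneg by (auto intro: mult_left_le_one_le)
  then show "0 < opt_prob \<alpha>" "opt_prob \<alpha> < 1"
    using p_bounds radius_less unfolding opt_prob_def by linarith+
qed

lemma V_eq:
  assumes "u (wealth w0 S \<pi> \<theta> a) \<le> u (wealth w0 S \<pi> \<theta> b)"
  shows "V P0 c \<alpha> u w0 S \<pi> \<theta> =
    (1 - opt_prob \<alpha>) * u (wealth w0 S \<pi> \<theta> a) + opt_prob \<alpha> * u (wealth w0 S \<pi> \<theta> b)"
  unfolding V_def INF_expectation[where X = "\<lambda>s. u (wealth w0 S \<pi> \<theta> s)", OF assms]
    SUP_expectation[where X = "\<lambda>s. u (wealth w0 S \<pi> \<theta> s)", OF assms] opt_prob_def
  by (simp add: algebra_simps)

text \<open>The price bound is the mean payoff under \<open>opt_prob\<close>: the standard deviation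
  of \<open>S\<close> is the payoff spread times that of the indicator of \<open>b\<close>, and
  \<open>\<alpha> < 1 / 2\<close> fixes the sign of \<open>\<delta>\<close>.\<close>

lemma pi_upper_eq:
  assumes "\<alpha> < 1 / 2" "S a < S b"
  shows "\<pi>_upper P0 c \<alpha> S = S a + opt_prob \<alpha> * (S b - S a)"
proof -
  have "measure_pmf.variance P0 S = (S b - S a)\<^sup>2 * (p * (1 - p))"
    unfolding expectation_eq by (simp add: power2_eq_square algebra_simps)
  then have std: "std_dev P0 S = (S b - S a) * sqrt (p * (1 - p))"
    using assms by (simp add: std_dev_def real_sqrt_mult)
  have del: "\<bar>\<delta> c \<alpha>\<bar> = sqrt (c - 1) * (1 - 2 * \<alpha>)"
    using assms c_ge by (simp add: \<delta>_def abs_mult)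
  have rad: "radius = sqrt (c - 1) * sqrt (p * (1 - p))"
    by (simp add: radius_def real_sqrt_mult)
  show ?thesis
    unfolding \<pi>_upper_def expectation_eq opt_prob_def std del rad by algebra
qed

end

section \<open>Optimal positions\<close>

lemma arg_max_set_eq_singleton_iff:
  fixes f :: "'a \<Rightarrow> real"
  shows "arg_max_set f A = {x} \<longleftrightarrow> x \<in> A \<and> (\<forall>y\<in>A. y \<noteq> x \<longrightarrow> f y < f x)"
proof
  assume "arg_max_set f A = {x}"
  then have eq: "is_arg_max f (\<lambda>y. y \<in> A) y \<longleftrightarrow> y = x" for y
    by (auto simp: arg_max_set_def set_eq_iff)
  then have x: "x \<in> A" "\<forall>y\<in>A. f y \<le> f x"
    using eq[of x] by (auto simp: is_arg_max_def not_less)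
  \<comment> \<open>A competitor with the same value would be a second maximizer.\<close>
  with eq show "x \<in> A \<and> (\<forall>y\<in>A. y \<noteq> x \<longrightarrow> f y < f x)"
    unfolding is_arg_max_linorder by (metis order.strict_iff_order order.trans)
next
  assume "x \<in> A \<and> (\<forall>y\<in>A. y \<noteq> x \<longrightarrow> f y < f x)"
  then show "arg_max_set f A = {x}"
    unfolding arg_max_set_def is_arg_max_def by (auto dest: order.strict_trans)
qed

lemma arg_max_set_uminus:
  fixes f :: "'a::ab_group_add \<Rightarrow> real"
  shows "arg_max_set (\<lambda>x. f (- x)) (uminus ` A) = uminus ` arg_max_set f A"
proof -
  have mem: "x \<in> uminus ` B \<longleftrightarrow> - x \<in> B" for x :: 'a and B
    by (metis image_iff minus_minus)
  have "(\<exists>y. - y \<in> A \<and> z < f (- y)) \<longleftrightarrow> (\<exists>y. y \<in> A \<and> z < f y)" for z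
    by (metis minus_minus)
  then show ?thesis
    by (simp add: set_eq_iff mem arg_max_set_def is_arg_max_def)
qed

text \<open>The two directions are kept apart because only existence of an optimum relies on the
  Inada condition.\<close>

lemma long_position:
  fixes P0 :: "'s::finite pmf" and S :: "'s \<Rightarrow> real" and \<pi> :: real
  assumes "CARD('s) = 2" "\<forall>s. pmf P0 s > 0" "1 \<le> c" "c < (MIN s. 1 / (1 - pmf P0 s))"
    and "\<exists>s t. S s \<noteq> S t" and \<alpha>: "0 \<le> \<alpha>" "\<alpha> < 1 / 2"
    and "utility I u w0"
  defines "opt \<equiv> arg_max_set (V P0 c \<alpha> u w0 S \<pi>) (admissible I w0 S \<pi> \<inter> {0..})"
  shows "(\<exists>\<theta>>0. opt = {\<theta>}) \<Longrightarrow> Min (range S) < \<pi> \<and> \<pi> < \<pi>_upper P0 c \<alpha> S"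
    and "inada I u \<Longrightarrow> Min (range S) < \<pi> \<and> \<pi> < \<pi>_upper P0 c \<alpha> S \<Longrightarrow> \<exists>\<theta>>0. opt = {\<theta>}"
proof -
  obtain a b where Sab: "S a < S b"
    using assms(5) by (metis linorder_less_linear)
  then have ab: "a \<noteq> b" by auto
  have univ: "UNIV = {a, b}"
    using card_subset_eq[of UNIV "{a, b}"] assms(1) ab by simp
  interpret two_states P0 c a b
    using ab univ assms by unfold_locales
  interpret utility I u w0 by fact
  define q x y where "q = opt_prob \<alpha>" and "x = \<pi> - S a" and "y = S b - \<pi>"
  have q: "0 < q" "q < 1" and xy: "0 < x + y"
    using opt_prob_bounds[OF \<alpha>] Sab by (auto simp: q_def x_def y_def)
  have W: "wealth w0 S \<pi> \<theta> a = w0 - \<theta> * x" "wealth w0 S \<pi> \<theta> b = w0 + \<theta> * y" for \<theta>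
    by (auto simp: wealth_def x_def y_def algebra_simps)
  have adm: "\<theta> \<in> admissible I w0 S \<pi> \<inter> {0..} \<longleftrightarrow> 0 \<le> \<theta> \<and> w0 - \<theta> * x \<in> I" for \<theta>
    using good_state_in[OF q xy] by (auto simp: admissible_def all_univ W)
  have V: "V P0 c \<alpha> u w0 S \<pi> \<theta> = eu q x y \<theta>" if "0 \<le> \<theta>" "w0 - \<theta> * x \<in> I" for \<theta>
    using V_eq[of u w0 S \<pi> \<theta>] mono_le[OF that(2) bad_state_le[OF q xy that(1)]]
    unfolding eu_def[OF q xy] by (simp add: W q_def)
  have opt_iff: "opt = {t} \<longleftrightarrow> (0 \<le> t \<and> w0 - t * x \<in> I) \<and>
      (\<forall>\<theta>. 0 \<le> \<theta> \<and> w0 - \<theta> * x \<in> I \<and> \<theta> \<noteq> t \<longrightarrow> eu q x y \<theta> < eu q x y t)" for t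
    unfolding opt_def arg_max_set_eq_singleton_iff Ball_def adm by (auto simp: V)
  have "Min (range S) = S a" unfolding univ using Sab by simp
  \<comment> \<open>In terms of \<open>x\<close> and \<open>y\<close>, the upper price bound says
    that the mean gain under \<open>q\<close> is positive.\<close>
  then have bounds: "Min (range S) < \<pi> \<longleftrightarrow> 0 < x" "\<pi> < \<pi>_upper P0 c \<alpha> S \<longleftrightarrow> x < q * (x + y)"
    using pi_upper_eq[OF \<alpha>(2) Sab] by (auto simp: x_def y_def q_def)
  show "Min (range S) < \<pi> \<and> \<pi> < \<pi>_upper P0 c \<alpha> S" if opt: "\<exists>\<theta>>0. opt = {\<theta>}"
    unfolding bounds
  proof (intro conjI; rule ccontr)
    obtain t where t: "0 < t" "w0 - t * x \<in> I"
      and max: "\<And>\<theta>. 0 \<le> \<theta> \<Longrightarrow> w0 - \<theta> * x \<in> I \<Longrightarrow> \<theta> \<noteq> t \<Longrightarrow> eu q x y \<theta> < eu q x y t"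
      using opt by (auto simp: opt_iff)
    show False if "\<not> 0 < x"
    proof -
      \<comment> \<open>A price at or below the lowest payoff leaves \<open>t + 1\<close> admissible
        and better than the supposed optimum \<open>t\<close>.\<close>
      have "w0 - (t + 1) * x \<in> I"
        using that by (intro upward[OF t(2)]) (simp add: algebra_simps)
      with max[of "t + 1"] eu_increasing[OF q xy, of t] t that show False by simp
    qed
    show False if "\<not> x < q * (x + y)"
      using max[of 0] eu_less_eu_0[OF q xy, of t] t that by simp
  qed
  show "\<exists>\<theta>>0. opt = {\<theta>}" if "inada I u" and "Min (range S) < \<pi> \<and> \<pi> < \<pi>_upper P0 c \<alpha> S"
    using eu_unique_max[OF q xy that(1)] that(2) unfolding bounds opt_iff
    by (metis less_imp_le)
qed

section \<open>Reflection between short and long positions\<close>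

lemma V_reflect: "V P0 c \<alpha> u w0 (\<lambda>s. - S s) (- \<pi>) \<theta> = V P0 c \<alpha> u w0 S \<pi> (- \<theta>)"
proof -
  have "wealth w0 (\<lambda>s. - S s) (- \<pi>) \<theta> = wealth w0 S \<pi> (- \<theta>)"
    by (auto simp: wealth_def algebra_simps)
  then show ?thesis by (simp add: V_def)
qed

lemma admissible_reflect:
  "admissible I w0 (\<lambda>s. - S s) (- \<pi>) \<inter> {0..} = uminus ` (admissible I w0 S \<pi> \<inter> {..0})"
proof -
  have "wealth w0 (\<lambda>s. - S s) (- \<pi>) \<theta> = wealth w0 S \<pi> (- \<theta>)" for \<theta>
    by (auto simp: wealth_def algebra_simps)
  then show ?thesis
    by (auto simp: admissible_def image_iff intro!: bexI[where x = "- _"])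
qed

text \<open>Under a change of sign the mean is odd and the standard deviation is even, so the two
  bounds are exchanged up to sign.\<close>

lemma pi_upper_reflect: "\<pi>_upper P0 c \<alpha> (\<lambda>s. - S s) = - \<pi>_lower P0 c \<alpha> S"
proof -
  have "(- S s + e)\<^sup>2 = (S s - e)\<^sup>2" for s e by (simp add: power2_eq_square algebra_simps)
  then show ?thesis by (simp add: \<pi>_upper_def \<pi>_lower_def std_dev_def)
qed

lemma Min_range_uminus:
  fixes S :: "'s::finite \<Rightarrow> real"
  shows "Min (range (\<lambda>s. - S s)) = - Max (range S)"
  using minus_Max_eq_Min[of "range S"] by (simp add: image_image)

theorem proposition2p13:
  fixes P0 :: "'s::finite pmf"
    and S :: "'s \<Rightarrow> real"
    and u :: "real \<Rightarrow> real"
    and I :: "real set"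
    and c \<alpha> w0 \<pi> :: real
  assumes "CARD('s) = 2"
    and "\<forall>s. pmf P0 s > 0"
    and "1 \<le> c"
    and "c < (MIN s. 1 / (1 - pmf P0 s))"
    and "\<exists>s t. S s \<noteq> S t"
    and "0 \<le> \<alpha>" and "\<alpha> < 1 / 2"
    and "I = UNIV \<or> (I = {0<..} \<and> w0 > 0)"
    and "twice_differentiable_on u I"
    and "strict_mono_on I u"
    and "strictly_concave_on I u"
  shows
    "(((\<exists>\<theta>>0. arg_max_set (V P0 c \<alpha> u w0 S \<pi>) (admissible I w0 S \<pi> \<inter> {0..}) = {\<theta>}) \<longrightarrow>
         Min (range S) < \<pi> \<and> \<pi> < \<pi>_upper P0 c \<alpha> S) \<and>
      (inada I u \<longrightarrow>
         Min (range S) < \<pi> \<and> \<pi> < \<pi>_upper P0 c \<alpha> S \<longrightarrow>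
         (\<exists>\<theta>>0. arg_max_set (V P0 c \<alpha> u w0 S \<pi>) (admissible I w0 S \<pi> \<inter> {0..}) = {\<theta>}))) \<and>
     (((\<exists>\<theta><0. arg_max_set (V P0 c \<alpha> u w0 S \<pi>) (admissible I w0 S \<pi> \<inter> {..0}) = {\<theta>}) \<longrightarrow>
         \<pi>_lower P0 c \<alpha> S < \<pi> \<and> \<pi> < Max (range S)) \<and>
      (inada I u \<longrightarrow>
         \<pi>_lower P0 c \<alpha> S < \<pi> \<and> \<pi> < Max (range S) \<longrightarrow>
         (\<exists>\<theta><0. arg_max_set (V P0 c \<alpha> u w0 S \<pi>) (admissible I w0 S \<pi> \<inter> {..0}) = {\<theta>})))"
proof -
  have u: "utility I u w0" using assms by unfold_locales
  note long = long_position[OF assms(1-4) _ assms(6,7) u]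
  let ?opt = "arg_max_set (V P0 c \<alpha> u w0 S \<pi>) (admissible I w0 S \<pi> \<inter> {..0})"
  let ?short = "\<exists>\<theta><0. ?opt = {\<theta>}"
  have "V P0 c \<alpha> u w0 (\<lambda>s. - S s) (- \<pi>) = (\<lambda>\<theta>. V P0 c \<alpha> u w0 S \<pi> (- \<theta>))"
    by (simp add: V_reflect fun_eq_iff)
  then have opt: "arg_max_set (V P0 c \<alpha> u w0 (\<lambda>s. - S s) (- \<pi>))
      (admissible I w0 (\<lambda>s. - S s) (- \<pi>) \<inter> {0..}) = uminus ` ?opt"
    by (simp only: admissible_reflect arg_max_set_uminus)
  \<comment> \<open>Uniqueness and the sign of the optimum transfer through the reflection.\<close>
  have "uminus ` B = {\<theta>} \<longleftrightarrow> B = {- \<theta>}" for B and \<theta> :: real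
    by (metis image_empty image_insert inj_image_eq_iff inj_uminus minus_minus)
  then have "(\<exists>\<theta>>0. uminus ` ?opt = {\<theta>}) \<longleftrightarrow> ?short"
    by (metis minus_minus neg_0_less_iff_less)
  then have "?short \<Longrightarrow> - Max (range S) < - \<pi> \<and> - \<pi> < - \<pi>_lower P0 c \<alpha> S"
    and "inada I u \<Longrightarrow> - Max (range S) < - \<pi> \<and> - \<pi> < - \<pi>_lower P0 c \<alpha> S \<Longrightarrow> ?short"
    using long[of "\<lambda>s. - S s" "- \<pi>"] assms(5)
    unfolding opt pi_upper_reflect Min_range_uminus neg_equal_iff_equal by metis+
  then show ?thesis
    unfolding neg_less_iff_less using long[OF assms(5), of \<pi>] by blast
qed

end
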